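(* Let $G$ be a compactly approximable topological group. If $E \subseteq G$ is finite and $\mathcal{U}$ is a uniform covering of $G_{r}$, then there exists a finite non-empty subset $F \subseteq G$ such that $\mu(F,gF,\mathcal{U}) = |F|$ for all $g \in E$.
   Context: A topological group $G$ is compactly approximable if there exists a directed set (with respect to inclusion) of compact subgroups of $G$ whose union is dense in $G$. A (not necessarily finite) set $\mathcal{U}$ of subsets of $G$ is a uniform covering of $G_r$ ($G$ with its right uniformity) if there is a neighborhood $U$ of the neutral element such that for every $x\in G$ the set $Ux$ is contained in some member of $\mathcal{U}$. For a covering $\mathcal{U}$ of a set $X$ and finite $E,F\subseteq X$, $\mu(E,F,\mathcal{U})$ is the maximal cardinality of the domain $D\subseteq E$ of an injective map $\phi\colon D\to F$ such that for every $x\in D$ there is $U\in\mathcal{U}$ with $\{x,\phi(x)\}\subseteq U$. *)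

theory Defs
  imports "HOL-Algebra.Coset" "HOL-Analysis.Analysis"
begin

text \<open>No separation axiom is imposed.\<close>

locale topological_group = group G for G (structure) +
  fixes T :: "'a topology"
  assumes topspace_eq_carrier: "topspace T = carrier G"
    and continuous_mult: "continuous_map (prod_topology T T) T (\<lambda>(x, y). x \<otimes> y)"
    and continuous_inv: "continuous_map T T (\<lambda>x. inv x)"

text \<open>\<open>closure_of\<close> is qualified because HOL-Algebra has its own notation of that name.\<close>

definition compactly_approximable :: "('a, 'b) monoid_scheme \<Rightarrow> 'a topology \<Rightarrow> bool" where
  "compactly_approximable G T \<longleftrightarrow>
     (\<exists>\<K>. \<K> \<noteq> {} \<and>
          (\<forall>H\<in>\<K>. subgroup H G \<and> compactin T H) \<and>
          (\<forall>H\<in>\<K>. \<forall>K\<in>\<K>. \<exists>L\<in>\<K>. H \<subseteq> L \<and> K \<subseteq> L) \<and>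
          Abstract_Topology.closure_of T (\<Union>\<K>) = carrier G)"

text \<open>Neighbourhoods of the neutral element need not be open.\<close>

definition right_uniform_covering ::
    "('a, 'b) monoid_scheme \<Rightarrow> 'a topology \<Rightarrow> 'a set set \<Rightarrow> bool" where
  "right_uniform_covering G T \<U> \<longleftrightarrow>
     \<U> \<subseteq> Pow (carrier G) \<and>
     (\<exists>U \<subseteq> carrier G. (\<exists>V. openin T V \<and> \<one>\<^bsub>G\<^esub> \<in> V \<and> V \<subseteq> U) \<and>
        (\<forall>x\<in>carrier G. \<exists>W\<in>\<U>. U #>\<^bsub>G\<^esub> x \<subseteq> W))"

text \<open>The set below contains \<open>0\<close> (take \<open>D = {}\<close>) and is bounded by \<open>card E\<close> when
  \<open>E\<close> is finite, which is the only case in which the maximum is meaningful.\<close>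

definition matching_number :: "'a set \<Rightarrow> 'a set \<Rightarrow> 'a set set \<Rightarrow> nat" where
  "matching_number E F \<U> =
     Max {card D | D. D \<subseteq> E \<and>
       (\<exists>\<phi>. inj_on \<phi> D \<and> \<phi> ` D \<subseteq> F \<and> (\<forall>x\<in>D. \<exists>U\<in>\<U>. {x, \<phi> x} \<subseteq> U))}"

end

theory Submission
  imports Defs
begin

text \<open>
  Let \<open>W\<close> be a neighbourhood of \<open>\<one>\<close> such that \<open>W W x\<close> always lies in a member of the covering.
  It suffices to find \<open>F\<close> and, for each \<open>g \<in> E\<close>, an injection of \<open>F\<close> into \<open>g F\<close> that moves every
  \<open>x\<close> inside \<open>W W x\<close>. One factor \<open>W\<close> is spent on replacing \<open>g\<close> by a group element \<open>h\<close> with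
  \<open>g h\<inverse> \<in> W\<close>. Compact approximability provides such an \<open>h\<close> for every \<open>g \<in> E\<close>, all of them in one
  compact subgroup \<open>K\<close> (lemma \<open>compactly_approximable_finite_approximation\<close>). Left multiplication by
  \<open>g h\<inverse>\<close> then carries \<open>h F\<close> onto \<open>g F\<close> and moves each point by an element of \<open>W\<close>.

  The other factor is used inside \<open>K\<close>. Left translation preserves the family of sets
  \<open>k N \<inter> K\<close>, \<open>k \<in> K\<close>, which are small for the left uniformity when \<open>N\<close> is small. As \<open>K\<close> is compact,
  conjugation by elements of \<open>K\<close> is equicontinuous at \<open>\<one>\<close>, so for suitable \<open>N\<close> these sets are
  also small for the right uniformity: points \<open>x, y\<close> of one set satisfy \<open>y \<in> W x\<close>. Compactness gives
  a finite set that meets all of them, and \<open>F\<close> is one of least cardinality. Each translate \<open>h F\<close>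
  with \<open>h \<in> K\<close> meets all of them too. Hall's theorem now matches \<open>F\<close> into \<open>h F\<close> within members of
  the family: a set \<open>S \<subseteq> F\<close> with too few neighbours in \<open>h F\<close> could be exchanged for these neighbours,
  which would give a smaller set meeting the whole family (lemma \<open>smallest_hitting_set_matching\<close>).
\<close>

section \<open>Matchings between finite hitting sets\<close>

text \<open>
  The induction follows Halmos and Vaughan. If some proper non-empty subfamily is tight, it has to
  use up its whole union, so it can be treated separately from the rest. If none is, every
  proper non-empty subfamily has a spare element, so one index may be assigned arbitrarily.
\<close>

lemma hall_marriage:
  fixes A :: "'i \<Rightarrow> 'a set"
  assumes "finite I" and "\<And>i. i \<in> I \<Longrightarrow> finite (A i)"
    and "\<And>J. J \<subseteq> I \<Longrightarrow> card J \<le> card (\<Union>(A ` J))"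
  shows "\<exists>\<phi>. inj_on \<phi> I \<and> (\<forall>i\<in>I. \<phi> i \<in> A i)"
  using assms
proof (induction "card I" arbitrary: I A rule: less_induct)
  case less
  note finI = less.prems(1) and finA = less.prems(2) and hall = less.prems(3)
  show ?case
  proof (cases "I = {}")
    case True
    then show ?thesis by auto
  next
    case nonempty: False
    show ?thesis
    proof (cases "\<exists>J. J \<noteq> {} \<and> J \<subset> I \<and> card (\<Union>(A ` J)) = card J")
      case True
      then obtain J where J: "J \<noteq> {}" "J \<subset> I" and tight: "card (\<Union>(A ` J)) = card J"
        by blast
      have finJ: "finite J"
        using J finI finite_subset by blast
      define B where "B i = A i - \<Union>(A ` J)" for i
      have "\<exists>\<phi>. inj_on \<phi> J \<and> (\<forall>i\<in>J. \<phi> i \<in> A i)"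
      proof (rule less.hyps)
        show "card J < card I"
          using J finI by (simp add: psubset_card_mono)
      qed (use finJ finA hall J in auto)
      then obtain \<phi> where \<phi>: "inj_on \<phi> J" "\<And>i. i \<in> J \<Longrightarrow> \<phi> i \<in> A i"
        by blast
      have "\<exists>\<psi>. inj_on \<psi> (I - J) \<and> (\<forall>i\<in>I - J. \<psi> i \<in> B i)"
      proof (rule less.hyps)
        show "card (I - J) < card I"
          using J finI by (intro psubset_card_mono) auto
        show "finite (B i)" if "i \<in> I - J" for i
          using that finA by (simp add: B_def)
        \<comment> \<open>A violation of Hall's condition for \<open>B\<close> at \<open>J'\<close> would be one for \<open>A\<close> at \<open>J \<union> J'\<close>.\<close>
        show "card J' \<le> card (\<Union>(B ` J'))" if J': "J' \<subseteq> I - J" for J'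
        proof -
          have finJ': "finite J'"
            using J' finI finite_subset by blast
          have "card J + card J' = card (J \<union> J')"
            using J' finJ finJ' by (subst card_Un_disjoint) auto
          also have "\<dots> \<le> card (\<Union>(A ` (J \<union> J')))"
            using J J' by (intro hall) auto
          also have "\<Union>(A ` (J \<union> J')) = \<Union>(A ` J) \<union> \<Union>(B ` J')"
            by (auto simp: B_def)
          also have "card \<dots> \<le> card J + card (\<Union>(B ` J'))"
            using card_Un_le tight by metis
          finally show ?thesis by simp
        qed
      qed (use finI in auto)
      then obtain \<psi> where \<psi>: "inj_on \<psi> (I - J)" "\<And>i. i \<in> I - J \<Longrightarrow> \<psi> i \<in> B i"
        by blast
      define \<theta> where "\<theta> i = (if i \<in> J then \<phi> i else \<psi> i)" for i
      have "\<theta> i \<noteq> \<theta> j" if "i \<in> J" "j \<in> I - J" for i j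
        using \<phi>(2)[OF that(1)] \<psi>(2)[OF that(2)] that by (auto simp: B_def \<theta>_def)
      then have "inj_on \<theta> I"
        using \<phi>(1) \<psi>(1) by (simp add: inj_on_def \<theta>_def) (metis Diff_iff)
      moreover have "\<forall>i\<in>I. \<theta> i \<in> A i"
        using \<phi>(2) \<psi>(2) by (auto simp: \<theta>_def B_def)
      ultimately show ?thesis by blast
    next
      case False
      obtain i where i: "i \<in> I"
        using nonempty by blast
      have "card {i} \<le> card (\<Union>(A ` {i}))"
        using i by (intro hall) auto
      then obtain y where y: "y \<in> A i"
        by fastforce
      define B where "B j = A j - {y}" for j
      have "\<exists>\<phi>. inj_on \<phi> (I - {i}) \<and> (\<forall>j\<in>I - {i}. \<phi> j \<in> B j)"
      proof (rule less.hyps)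
        show "card (I - {i}) < card I"
          using finI i by (rule card_Diff1_less)
        show "finite (B j)" if "j \<in> I - {i}" for j
          using that finA by (simp add: B_def)
        show "card J \<le> card (\<Union>(B ` J))" if J: "J \<subseteq> I - {i}" for J
        proof (cases "J = {}")
          case nonempty_J: False
          have "J \<subset> I"
            using J i by auto
          then have "card J < card (\<Union>(A ` J))"
            using False nonempty_J hall[of J] by (metis order_le_less psubset_imp_subset)
          moreover have "\<Union>(B ` J) = \<Union>(A ` J) - {y}"
            by (auto simp: B_def)
          ultimately show ?thesis
            using card_Diff_singleton_if[of "\<Union>(A ` J)" y] by (auto split: if_splits)
        qed auto
      qed (use finI in auto)
      then obtain \<phi> where \<phi>: "inj_on \<phi> (I - {i})" "\<And>j. j \<in> I - {i} \<Longrightarrow> \<phi> j \<in> B j"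
        by blast
      have "inj_on (\<phi>(i := y)) (insert i (I - {i}))"
        using \<phi> by (subst inj_on_insert) (auto simp: B_def inj_on_def)
      moreover have "insert i (I - {i}) = I"
        using i by auto
      moreover have "\<forall>j\<in>I. (\<phi>(i := y)) j \<in> A j"
        using \<phi>(2) y by (auto simp: B_def)
      ultimately show ?thesis by metis
    qed
  qed
qed

text \<open>
  If \<open>S \<subseteq> F\<close> had fewer than \<open>card S\<close> partners in \<open>F'\<close>, replacing \<open>S\<close> by its partners would
  shrink \<open>F\<close>. The result still meets every \<open>C\<close>: where \<open>F\<close> meets \<open>C\<close> only in \<open>S\<close>, the points of
  \<open>F' \<inter> C\<close> are partners of a point of \<open>S\<close>.
\<close>

lemma smallest_hitting_set_matching:
  assumes "finite F" "finite F'"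
    and hitF: "\<And>C. C \<in> \<C> \<Longrightarrow> F \<inter> C \<noteq> {}"
    and hitF': "\<And>C. C \<in> \<C> \<Longrightarrow> F' \<inter> C \<noteq> {}"
    and least: "\<And>H. H \<subseteq> F \<union> F' \<Longrightarrow> (\<And>C. C \<in> \<C> \<Longrightarrow> H \<inter> C \<noteq> {}) \<Longrightarrow> card F \<le> card H"
  shows "\<exists>\<phi>. inj_on \<phi> F \<and> (\<forall>x\<in>F. \<phi> x \<in> F' \<and> (\<exists>C\<in>\<C>. x \<in> C \<and> \<phi> x \<in> C))"
proof -
  define A where "A x = {y \<in> F'. \<exists>C\<in>\<C>. x \<in> C \<and> y \<in> C}" for x
  have "\<exists>\<phi>. inj_on \<phi> F \<and> (\<forall>x\<in>F. \<phi> x \<in> A x)"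
  proof (rule hall_marriage)
    show "card S \<le> card (\<Union>(A ` S))" if S: "S \<subseteq> F" for S
    proof -
      let ?H = "(F - S) \<union> \<Union>(A ` S)"
      have "?H \<inter> C \<noteq> {}" if C: "C \<in> \<C>" for C
      proof -
        obtain x where x: "x \<in> F" "x \<in> C"
          using hitF[OF C] by auto
        obtain y where y: "y \<in> F'" "y \<in> C"
          using hitF'[OF C] by auto
        show ?thesis
        proof (cases "x \<in> S")
          case True
          then have "y \<in> \<Union>(A ` S)"
            using x y C by (auto simp: A_def)
          then show ?thesis
            using y by blast
        qed (use x in auto)
      qed
      then have "card F \<le> card ?H"
        by (intro least) (auto simp: A_def)
      also have "\<dots> \<le> card (F - S) + card (\<Union>(A ` S))"
        by (rule card_Un_le)
      also have "card (F - S) = card F - card S"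
        using S assms(1) by (meson card_Diff_subset finite_subset)
      finally show ?thesis
        using card_mono[OF assms(1) S] by linarith
    qed
  qed (use assms(1,2) in \<open>auto simp: A_def\<close>)
  then show ?thesis
    by (auto simp: A_def)
qed

lemma matching_number_eq_card:
  assumes "finite F" and "inj_on \<phi> F" and "\<phi> ` F \<subseteq> F'"
    and "\<And>x. x \<in> F \<Longrightarrow> \<exists>U\<in>\<U>. {x, \<phi> x} \<subseteq> U"
  shows "matching_number F F' \<U> = card F"
  unfolding matching_number_def
proof (rule Max_eqI)
  let ?M = "{card D |D. D \<subseteq> F \<and>
       (\<exists>\<phi>. inj_on \<phi> D \<and> \<phi> ` D \<subseteq> F' \<and> (\<forall>x\<in>D. \<exists>U\<in>\<U>. {x, \<phi> x} \<subseteq> U))}"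
  show le: "n \<le> card F" if "n \<in> ?M" for n
    using that assms(1) by (auto intro: card_mono)
  show "finite ?M"
    using le by (meson finite_nat_set_iff_bounded_le)
  show "card F \<in> ?M"
    using assms(2-4) by blast
qed

section \<open>Compact subgroups of a topological group\<close>

context topological_group
begin

lemma continuous_map_mult [continuous_intros]:
  assumes "continuous_map X T f" "continuous_map X T g"
  shows "continuous_map X T (\<lambda>x. f x \<otimes> g x)"
proof -
  have "continuous_map X (prod_topology T T) (\<lambda>x. (f x, g x))"
    using assms by (simp add: continuous_map_pairedI)
  from continuous_map_compose[OF this continuous_mult] show ?thesis
    by (simp add: o_def)
qed

lemma continuous_map_inverse [continuous_intros]:
  "continuous_map X T f \<Longrightarrow> continuous_map X T (\<lambda>x. inv (f x))"
  using continuous_map_compose[OF _ continuous_inv] by (fastforce simp: o_def)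

lemma neighbourhood_for_binary_map:
  assumes V: "openin T V" "\<one> \<in> V" and c: "continuous_map (prod_topology T T) T (\<lambda>p. f (fst p) (snd p))"
    and "f \<one> \<one> = \<one>"
  obtains W where "openin T W" "\<one> \<in> W" "\<And>a b. a \<in> W \<Longrightarrow> b \<in> W \<Longrightarrow> f a b \<in> V"
proof -
  let ?O = "{p \<in> topspace (prod_topology T T). f (fst p) (snd p) \<in> V}"
  have "openin (prod_topology T T) ?O"
    using c V(1) by (rule openin_continuous_map_preimage)
  moreover have "(\<one>, \<one>) \<in> ?O"
    using assms by (simp add: topspace_eq_carrier)
  ultimately obtain A B where AB: "openin T A" "openin T B" "\<one> \<in> A" "\<one> \<in> B" "A \<times> B \<subseteq> ?O"
    unfolding openin_prod_topology_alt by meson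
  show thesis
  proof
    show "openin T (A \<inter> B)"
      using AB by auto
    show "f a b \<in> V" if "a \<in> A \<inter> B" "b \<in> A \<inter> B" for a b
      using that AB(5) by (auto dest: subsetD[where c = "(a, b)"])
  qed (use AB in auto)
qed

text \<open>
  On a compact set of conjugators, conjugation is equicontinuous at the neutral element. By Wallace's
  theorem the open set of pairs \<open>(k, m)\<close> with \<open>k m k\<inverse> \<in> W\<close>, which contains \<open>K \<times> {\<one>}\<close>, contains an open
  box around it.
\<close>

lemma compact_conjugation_neighbourhood:
  assumes "compactin T K" and W: "openin T W" "\<one> \<in> W"
  obtains M where "openin T M" "\<one> \<in> M"
    "\<And>k m. k \<in> K \<Longrightarrow> m \<in> M \<Longrightarrow> k \<otimes> m \<otimes> inv k \<in> W"
proof -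
  have K: "K \<subseteq> carrier G"
    using assms(1) compactin_subset_topspace topspace_eq_carrier by blast
  let ?c = "\<lambda>p. fst p \<otimes> snd p \<otimes> inv (fst p)"
  let ?O = "{p \<in> topspace (prod_topology T T). ?c p \<in> W}"
  have "continuous_map (prod_topology T T) T ?c"
    by (intro continuous_intros continuous_map_fst continuous_map_snd)
  then have "openin (prod_topology T T) ?O"
    using W(1) by (rule openin_continuous_map_preimage)
  moreover have "compactin T {\<one>}"
    by (simp add: topspace_eq_carrier)
  moreover have "K \<times> {\<one>} \<subseteq> ?O"
    using K W by (auto simp: topspace_eq_carrier)
  ultimately obtain A M where AM: "openin T A" "openin T M" "K \<subseteq> A" "{\<one>} \<subseteq> M" "A \<times> M \<subseteq> ?O"
    using assms(1) Wallace_theorem_prod_topology[of T K T "{\<one>}" ?O] by blast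
  show thesis
  proof
    show "k \<otimes> m \<otimes> inv k \<in> W" if "k \<in> K" "m \<in> M" for k m
      using that AM(3,5) by (auto dest: subsetD[where c = "(k, m)"])
  qed (use AM in auto)
qed

lemma compact_finite_translates:
  assumes "compactin T K" and N: "openin T N" "\<one> \<in> N"
  obtains F where "finite F" "F \<subseteq> K" "\<And>k. k \<in> K \<Longrightarrow> \<exists>x\<in>F. inv k \<otimes> x \<in> N"
proof -
  have K: "K \<subseteq> carrier G"
    using assms(1) compactin_subset_topspace topspace_eq_carrier by blast
  define P where "P x = {k \<in> topspace T. inv k \<otimes> x \<in> N}" for x
  have openP: "openin T (P x)" if "x \<in> K" for x
  proof -
    have "continuous_map T T (\<lambda>k. inv k \<otimes> x)"
      using that K by (intro continuous_intros) (auto simp: topspace_eq_carrier)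
    then show ?thesis
      unfolding P_def using N(1) by (rule openin_continuous_map_preimage)
  qed
  have "K \<subseteq> \<Union>(P ` K)"
    using K N(2) by (force simp: P_def topspace_eq_carrier)
  then obtain \<F> where \<F>: "finite \<F>" "\<F> \<subseteq> P ` K" "K \<subseteq> \<Union>\<F>"
    using assms(1) openP unfolding compactin_def by (metis (no_types, lifting) imageE)
  then obtain F where "F \<subseteq> K" "finite F" "\<F> = P ` F"
    by (meson finite_subset_image)
  with \<F>(3) show thesis
    by (intro that[of F]) (auto simp: P_def)
qed

text \<open>
  Closeness of \<open>x\<close> and \<open>\<phi> x\<close> is required in the right uniformity, while the translations act on
  the left; compactness of \<open>K\<close> reconciles the two. The family of sets
  \<open>k N \<inter> K\<close> is left-invariant, which makes \<open>h F\<close> meet all its members when \<open>F\<close> does; the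
  conjugation-controlled \<open>M\<close> converts closeness within such a set to the other side.
\<close>

lemma compact_subgroup_translate_matching:
  assumes "subgroup K G" "compactin T K" and W: "openin T W" "\<one> \<in> W"
  obtains F where "finite F" "F \<noteq> {}" "F \<subseteq> K"
    "\<And>h. h \<in> K \<Longrightarrow> \<exists>\<phi>. inj_on \<phi> F \<and> (\<forall>x\<in>F. \<phi> x \<in> h <# F \<and> \<phi> x \<otimes> inv x \<in> W)"
proof -
  interpret K: subgroup K G by fact
  note K = K.subset
  obtain M where M: "openin T M" "\<one> \<in> M"
    and conj: "\<And>k m. k \<in> K \<Longrightarrow> m \<in> M \<Longrightarrow> k \<otimes> m \<otimes> inv k \<in> W"
    by (rule compact_conjugation_neighbourhood[OF assms(2) W]) blast
  have "continuous_map (prod_topology T T) T (\<lambda>p. inv (fst p) \<otimes> snd p)"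
    by (intro continuous_intros continuous_map_fst continuous_map_snd)
  then obtain N where N: "openin T N" "\<one> \<in> N"
    and diff: "\<And>a b. a \<in> N \<Longrightarrow> b \<in> N \<Longrightarrow> inv a \<otimes> b \<in> M"
    using neighbourhood_for_binary_map[OF M, where f = "\<lambda>a b. inv a \<otimes> b"] by auto
  define hits where "hits H \<longleftrightarrow> finite H \<and> H \<subseteq> K \<and> (\<forall>k\<in>K. \<exists>x\<in>H. inv k \<otimes> x \<in> N)" for H
  have "\<exists>H. hits H"
    using compact_finite_translates[OF assms(2) N] unfolding hits_def by metis
  then obtain F where F: "hits F" and least: "\<And>H. hits H \<Longrightarrow> card F \<le> card H"
    using ex_has_least_nat[of hits _ card] by blast
  have finF: "finite F" and FK: "F \<subseteq> K" and hitF: "\<And>k. k \<in> K \<Longrightarrow> \<exists>x\<in>F. inv k \<otimes> x \<in> N"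
    using F by (auto simp: hits_def)
  show thesis
  proof
    show "F \<noteq> {}"
      using hitF[OF K.one_closed] by auto
    fix h assume h: "h \<in> K"
    define C where "C k = {x \<in> K. inv k \<otimes> x \<in> N}" for k
    have hF: "h <# F \<subseteq> K"
      using h FK by (auto simp: l_coset_def)
    have fin_hF: "finite (h <# F)"
      using finF by (simp add: l_coset_def)
    have hit_hF: "\<exists>y\<in>h <# F. inv k \<otimes> y \<in> N" if k: "k \<in> K" for k
    proof -
      have "inv h \<otimes> k \<in> K"
        using h k by simp
      then obtain x where x: "x \<in> F" "inv (inv h \<otimes> k) \<otimes> x \<in> N"
        using hitF by blast
      have "inv (inv h \<otimes> k) \<otimes> x = inv k \<otimes> (h \<otimes> x)"
        using h k x(1) FK K by (simp add: subset_iff inv_mult_group m_assoc)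
      then show ?thesis
        using x by (auto simp: l_coset_def)
    qed
    have "\<exists>\<phi>. inj_on \<phi> F \<and> (\<forall>x\<in>F. \<phi> x \<in> h <# F \<and> (\<exists>D\<in>C ` K. x \<in> D \<and> \<phi> x \<in> D))"
    proof (rule smallest_hitting_set_matching[OF finF fin_hF])
      show "F \<inter> D \<noteq> {}" if "D \<in> C ` K" for D
        using that hitF FK by (fastforce simp: C_def)
      show "(h <# F) \<inter> D \<noteq> {}" if "D \<in> C ` K" for D
        using that hit_hF hF by (fastforce simp: C_def)
      fix H assume H: "H \<subseteq> F \<union> (h <# F)" "\<And>D. D \<in> C ` K \<Longrightarrow> H \<inter> D \<noteq> {}"
      have "\<exists>x\<in>H. inv k \<otimes> x \<in> N" if "k \<in> K" for k
        using H(2)[of "C k"] that by (auto simp: C_def)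
      moreover have "finite H"
        using H(1) finF fin_hF by (meson finite_UnI finite_subset)
      ultimately have "hits H"
        using H(1) FK hF by (auto simp: hits_def)
      then show "card F \<le> card H"
        by (rule least)
    qed
    then obtain \<phi> where \<phi>: "inj_on \<phi> F"
      "\<And>x. x \<in> F \<Longrightarrow> \<phi> x \<in> h <# F \<and> (\<exists>k\<in>K. x \<in> C k \<and> \<phi> x \<in> C k)"
      by auto
    \<comment> \<open>Since \<open>x\<inverse> (\<phi> x) \<in> M\<close>, conjugation by \<open>x \<in> K\<close> moves it to \<open>(\<phi> x) x\<inverse> \<in> W\<close>.\<close>
    have "\<phi> x \<otimes> inv x \<in> W" if x: "x \<in> F" for x
    proof -
      obtain k where k: "k \<in> K" "x \<in> C k" "\<phi> x \<in> C k"
        using \<phi>(2)[OF x] by blast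
      have car: "x \<in> carrier G" "k \<in> carrier G" "\<phi> x \<in> carrier G"
        using k K by (auto simp: C_def)
      have "inv (inv k \<otimes> x) \<otimes> (inv k \<otimes> \<phi> x) \<in> M"
        using k by (intro diff) (auto simp: C_def)
      also have "inv (inv k \<otimes> x) \<otimes> (inv k \<otimes> \<phi> x) = inv x \<otimes> \<phi> x"
      proof -
        have "k \<otimes> (inv k \<otimes> \<phi> x) = \<phi> x"
          using car by (simp flip: m_assoc)
        then show ?thesis
          using car by (simp add: inv_mult_group m_assoc)
      qed
      finally have "x \<otimes> (inv x \<otimes> \<phi> x) \<otimes> inv x \<in> W"
        using k by (intro conj) (auto simp: C_def)
      moreover have "x \<otimes> (inv x \<otimes> \<phi> x) = \<phi> x"
        using car by (simp flip: m_assoc)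
      ultimately show ?thesis by simp
    qed
    with \<phi> show "\<exists>\<phi>. inj_on \<phi> F \<and> (\<forall>x\<in>F. \<phi> x \<in> h <# F \<and> \<phi> x \<otimes> inv x \<in> W)"
      by blast
  qed (use finF FK in auto)
qed

text \<open>
  Density approximates each \<open>g\<close> separately; directedness puts the finitely many approximants into
  a single subgroup.
\<close>

lemma compactly_approximable_finite_approximation:
  assumes "compactly_approximable G T" and "finite E" "E \<subseteq> carrier G"
    and W: "openin T W" "\<one> \<in> W"
  obtains K where "subgroup K G" "compactin T K" "\<And>g. g \<in> E \<Longrightarrow> \<exists>h\<in>K. g \<otimes> inv h \<in> W"
proof -
  obtain \<K> where ne: "\<K> \<noteq> {}"
    and cpt: "\<And>H. H \<in> \<K> \<Longrightarrow> subgroup H G \<and> compactin T H"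
    and dir: "\<And>H K. H \<in> \<K> \<Longrightarrow> K \<in> \<K> \<Longrightarrow> \<exists>L\<in>\<K>. H \<subseteq> L \<and> K \<subseteq> L"
    and dense: "Abstract_Topology.closure_of T (\<Union>\<K>) = carrier G"
    using assms(1) unfolding compactly_approximable_def by metis
  have approx: "\<exists>h\<in>\<Union>\<K>. g \<otimes> inv h \<in> W" if g: "g \<in> carrier G" for g
  proof -
    let ?O = "{h \<in> topspace T. g \<otimes> inv h \<in> W}"
    have "continuous_map T T (\<lambda>h. g \<otimes> inv h)"
      using g by (intro continuous_intros) (auto simp: topspace_eq_carrier)
    then have "openin T ?O"
      using W(1) by (rule openin_continuous_map_preimage)
    moreover have "g \<in> ?O"
      using g W(2) by (simp add: topspace_eq_carrier)
    moreover have "g \<in> Abstract_Topology.closure_of T (\<Union>\<K>)"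
      using g dense by simp
    ultimately have "\<exists>h. h \<in> \<Union>\<K> \<and> h \<in> ?O"
      unfolding in_closure_of by (elim conjE allE[of _ ?O]) simp
    then show ?thesis
      by auto
  qed
  have "\<exists>K\<in>\<K>. \<forall>g\<in>E. \<exists>h\<in>K. g \<otimes> inv h \<in> W"
    using assms(2,3)
  proof (induction E rule: finite_induct)
    case empty
    then show ?case using ne by auto
  next
    case (insert g E)
    then obtain K where K: "K \<in> \<K>" "\<forall>g\<in>E. \<exists>h\<in>K. g \<otimes> inv h \<in> W"
      by auto
    obtain h H where h: "h \<in> H" "H \<in> \<K>" "g \<otimes> inv h \<in> W"
      using approx insert.prems by blast
    obtain L where "L \<in> \<K>" "H \<subseteq> L" "K \<subseteq> L"
      using dir K(1) h(2) by metis
    then show ?case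
      using K h by (intro bexI[of _ L]) (auto 0 3)
  qed
  then show thesis
    using cpt by (metis that)
qed

end

section \<open>Matchings in compactly approximable groups\<close>

theorem proposition8p2:
  fixes G :: "('a, 'b) monoid_scheme" and T :: "'a topology"
    and E :: "'a set" and \<U> :: "'a set set"
  assumes "topological_group G T"
    and "compactly_approximable G T"
    and "finite E" and "E \<subseteq> carrier G"
    and "right_uniform_covering G T \<U>"
  shows "\<exists>F. finite F \<and> F \<noteq> {} \<and> F \<subseteq> carrier G \<and>
           (\<forall>g\<in>E. matching_number F (g <#\<^bsub>G\<^esub> F) \<U> = card F)"
proof -
  interpret topological_group G T by fact
  obtain U V where V: "openin T V" "\<one>\<^bsub>G\<^esub> \<in> V" "V \<subseteq> U"
    and cover: "\<And>x. x \<in> carrier G \<Longrightarrow> \<exists>A\<in>\<U>. U #>\<^bsub>G\<^esub> x \<subseteq> A"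
    using assms(5) unfolding right_uniform_covering_def by (elim conjE exE) metis
  have "continuous_map (prod_topology T T) T (\<lambda>p. fst p \<otimes>\<^bsub>G\<^esub> snd p)"
    by (intro continuous_intros continuous_map_fst continuous_map_snd)
  then obtain W where W: "openin T W" "\<one>\<^bsub>G\<^esub> \<in> W"
    and WW: "\<And>a b. a \<in> W \<Longrightarrow> b \<in> W \<Longrightarrow> a \<otimes>\<^bsub>G\<^esub> b \<in> V"
    using neighbourhood_for_binary_map[OF V(1,2), where f = "\<lambda>a b. a \<otimes>\<^bsub>G\<^esub> b"] by auto
  obtain K where K: "subgroup K G" "compactin T K"
    and approx: "\<And>g. g \<in> E \<Longrightarrow> \<exists>h\<in>K. g \<otimes>\<^bsub>G\<^esub> inv\<^bsub>G\<^esub> h \<in> W"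
    by (rule compactly_approximable_finite_approximation[OF assms(2-4) W]) blast
  obtain F where F: "finite F" "F \<noteq> {}" "F \<subseteq> K"
    and match: "\<And>h. h \<in> K \<Longrightarrow>
      \<exists>\<phi>. inj_on \<phi> F \<and> (\<forall>x\<in>F. \<phi> x \<in> h <#\<^bsub>G\<^esub> F \<and> \<phi> x \<otimes>\<^bsub>G\<^esub> inv\<^bsub>G\<^esub> x \<in> W)"
    by (rule compact_subgroup_translate_matching[OF K W]) blast
  have KG: "K \<subseteq> carrier G"
    using K(1) by (rule subgroup.subset)
  have "matching_number F (g <#\<^bsub>G\<^esub> F) \<U> = card F" if g: "g \<in> E" for g
  proof -
    have gG: "g \<in> carrier G"
      using g assms(4) by auto
    obtain h where h: "h \<in> K" "g \<otimes>\<^bsub>G\<^esub> inv\<^bsub>G\<^esub> h \<in> W"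
      using approx[OF g] by blast
    have hG: "h \<in> carrier G"
      using h KG by auto
    obtain \<phi> where inj: "inj_on \<phi> F" and \<phi>: "\<And>x. x \<in> F \<Longrightarrow> \<phi> x \<in> h <#\<^bsub>G\<^esub> F"
      and close: "\<And>x. x \<in> F \<Longrightarrow> \<phi> x \<otimes>\<^bsub>G\<^esub> inv\<^bsub>G\<^esub> x \<in> W"
      using match[OF h(1)] by blast
    have \<phi>G: "\<phi> x \<in> carrier G" if "x \<in> F" for x
      using \<phi>[OF that] hG F(3) KG by (auto simp: l_coset_def)
    \<comment> \<open>Correct the matching of \<open>F\<close> into \<open>h F\<close> by the small element \<open>g h\<inverse>\<close>.\<close>
    define \<psi> where "\<psi> x = g \<otimes>\<^bsub>G\<^esub> inv\<^bsub>G\<^esub> h \<otimes>\<^bsub>G\<^esub> \<phi> x" for x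
    show ?thesis
    proof (rule matching_number_eq_card[OF F(1)])
      show "inj_on \<psi> F"
        using inj gG hG \<phi>G by (simp add: inj_on_def \<psi>_def)
      show "\<psi> ` F \<subseteq> g <#\<^bsub>G\<^esub> F"
      proof
        fix y assume "y \<in> \<psi> ` F"
        then obtain x where x: "x \<in> F" "y = \<psi> x" by blast
        obtain z where z: "z \<in> F" "\<phi> x = h \<otimes>\<^bsub>G\<^esub> z"
          using \<phi>[OF x(1)] by (auto simp: l_coset_def)
        have "z \<in> carrier G"
          using z F(3) KG by auto
        then have "inv\<^bsub>G\<^esub> h \<otimes>\<^bsub>G\<^esub> (h \<otimes>\<^bsub>G\<^esub> z) = z"
          using hG by (simp flip: m_assoc)
        then have "y = g \<otimes>\<^bsub>G\<^esub> z"
          using x z gG hG \<open>z \<in> carrier G\<close> by (simp add: \<psi>_def m_assoc)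
        then show "y \<in> g <#\<^bsub>G\<^esub> F"
          using z by (auto simp: l_coset_def)
      qed
      show "\<exists>A\<in>\<U>. {x, \<psi> x} \<subseteq> A" if x: "x \<in> F" for x
      proof -
        have xG: "x \<in> carrier G"
          using x F(3) KG by auto
        have "(g \<otimes>\<^bsub>G\<^esub> inv\<^bsub>G\<^esub> h) \<otimes>\<^bsub>G\<^esub> (\<phi> x \<otimes>\<^bsub>G\<^esub> inv\<^bsub>G\<^esub> x) \<in> U"
          using WW[OF h(2) close[OF x]] V(3) by blast
        moreover have "\<psi> x = (g \<otimes>\<^bsub>G\<^esub> inv\<^bsub>G\<^esub> h) \<otimes>\<^bsub>G\<^esub> (\<phi> x \<otimes>\<^bsub>G\<^esub> inv\<^bsub>G\<^esub> x) \<otimes>\<^bsub>G\<^esub> x"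
          using gG hG xG \<phi>G[OF x] by (simp add: \<psi>_def m_assoc)
        ultimately have "\<psi> x \<in> U #>\<^bsub>G\<^esub> x"
          by (auto simp: r_coset_def)
        moreover have "x \<in> U #>\<^bsub>G\<^esub> x"
          using V xG by (force simp: r_coset_def)
        ultimately show ?thesis
          using cover[OF xG] by blast
      qed
    qed
  qed
  then show ?thesis
    using F KG by (intro exI[of _ F]) auto
qed

end
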